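(* Let $R$ be a weakly fadelian ring. If $R$ is right Ore, then $R$ is fadelian.
   Context: All rings are nontrivial ($1\neq 0$), unital, associative, and not assumed commutative. A ring $R$ is weakly fadelian if for every nonzero $a\in R$ there exist $b,c\in R$ such that $1=ab+ca$. A ring $R$ is fadelian if for every $x\in R$ and every nonzero $a\in R$ there exist $b,c\in R$ such that $x=ab+ca$. A ring is integral if it has no zero divisors ($xy=0$ implies $x=0$ or $y=0$); every weakly fadelian ring is integral. An integral ring $R$ is right Ore if any two nonzero right ideals of $R$ have a nonzero intersection. *)

theory Defs
  imports Main
begin

text \<open>
  The class \<^class>\<open>ring_1\<close> is that of associative, unital, not necessarily commutative rings
  with \<open>0 \<noteq> 1\<close>. Properties of the ring as a whole are predicates on its type.
\<close>

definition weakly_fadelian :: "'a::ring_1 itself \<Rightarrow> bool" where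
  "weakly_fadelian _ \<longleftrightarrow> (\<forall>a::'a. a \<noteq> 0 \<longrightarrow> (\<exists>b c. 1 = a * b + c * a))"

definition fadelian :: "'a::ring_1 itself \<Rightarrow> bool" where
  "fadelian _ \<longleftrightarrow> (\<forall>x a::'a. a \<noteq> 0 \<longrightarrow> (\<exists>b c. x = a * b + c * a))"

definition right_ideal :: "'a::ring_1 set \<Rightarrow> bool" where
  "right_ideal I \<longleftrightarrow>
     0 \<in> I \<and> (\<forall>x\<in>I. \<forall>y\<in>I. x + y \<in> I) \<and> (\<forall>x\<in>I. - x \<in> I) \<and> (\<forall>x\<in>I. \<forall>r. x * r \<in> I)"

text \<open>
  The notion is meant for rings without zero divisors, but the absence of zero divisors is not
  part of the predicate. Weakly fadelian rings have no zero divisors, so nothing is lost there.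
\<close>

definition right_Ore :: "'a::ring_1 itself \<Rightarrow> bool" where
  "right_Ore _ \<longleftrightarrow>
     (\<forall>I J :: 'a set. right_ideal I \<and> I \<noteq> {0} \<and> right_ideal J \<and> J \<noteq> {0} \<longrightarrow> I \<inter> J \<noteq> {0})"

end

theory Submission
  imports Defs
begin

text \<open>
  Let \<open>a \<noteq> 0\<close> and let \<open>x\<close> be the element to be written as \<open>a b + c a\<close>. It is enough to find
  \<open>w \<noteq> 0\<close> with \<open>w \<in> R a\<close> and \<open>x w \<in> a R\<close>: multiplying \<open>1 = w b + c w\<close> by \<open>x\<close> on the left gives
  \<open>x = (x w) b + (x c) w \<in> a R + R a\<close>. The condition \<open>x w \<in> a R\<close> defines a right ideal of
  elements \<open>w\<close>, and the Ore condition says that it contains some \<open>u \<noteq> 0\<close>. Being a right ideal,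
  it then contains \<open>u a\<close>, which lies in \<open>R a\<close>. Finally \<open>u a \<noteq> 0\<close>, since \<open>R\<close> has no zero
  divisors. This last fact also follows from the weakly fadelian property
  (\<open>weakly_fadelian_integral\<close>), by way of idempotents and then elements of square zero.
\<close>

lemma weakly_fadelianE:
  fixes a :: "'a::ring_1"
  assumes "weakly_fadelian TYPE('a)" and "a \<noteq> 0"
  obtains b c where "1 = a * b + c * a"
  using assms unfolding weakly_fadelian_def by blast

text \<open>
  If \<open>e\<close> is idempotent, then \<open>e R + R e\<close> is killed by \<open>y \<mapsto> (1 - e) y (1 - e)\<close>, which sends
  \<open>1\<close> to \<open>1 - e\<close>.
\<close>

lemma weakly_fadelian_idempotent:
  fixes e :: "'a::ring_1"
  assumes wf: "weakly_fadelian TYPE('a)" and idem: "e * e = e"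
  shows "e = 0 \<or> e = 1"
proof (cases "e = 0")
  case False
  then obtain b c where one: "1 = e * b + c * e"
    by (rule weakly_fadelianE[OF wf])
  have left: "(1 - e) * e = 0" and right: "e * (1 - e) = 0"
    using idem by (simp_all add: algebra_simps)
  have "1 - e = (1 - e) * (1 - e)"
    using right by (simp add: left_diff_distrib)
  also have "\<dots> = (1 - e) * (e * b + c * e) * (1 - e)"
    by (simp flip: one)
  also have "\<dots> = ((1 - e) * e) * b * (1 - e) + (1 - e) * c * (e * (1 - e))"
    by (simp only: distrib_left distrib_right mult.assoc)
  also have "\<dots> = 0"
    by (simp only: left right mult_zero_left mult_zero_right add_0_left)
  finally show ?thesis by simp
qed simp

text \<open>
  If \<open>a a = 0\<close> and \<open>1 = a b + c a\<close>, then \<open>a = a c a\<close>, so \<open>c a\<close> is idempotent. It cannot be \<open>1\<close>,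
  because \<open>(c a) a = 0\<close>, and it cannot be \<open>0\<close>, because \<open>a (c a) = a\<close>.
\<close>

lemma weakly_fadelian_reduced:
  fixes a :: "'a::ring_1"
  assumes wf: "weakly_fadelian TYPE('a)" and sq: "a * a = 0"
  shows "a = 0"
proof (rule ccontr)
  assume "a \<noteq> 0"
  then obtain b c where one: "1 = a * b + c * a"
    by (rule weakly_fadelianE[OF wf])
  have "a = a * (a * b + c * a)"
    by (simp flip: one)
  also have "\<dots> = (a * a) * b + a * c * a"
    by (simp only: distrib_left mult.assoc)
  finally have aca: "a * (c * a) = a"
    using sq by (simp add: mult.assoc)
  then have "(c * a) * (c * a) = c * a"
    by (simp add: mult.assoc)
  then have "c * a = 0 \<or> c * a = 1"
    by (rule weakly_fadelian_idempotent[OF wf])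
  moreover have "c * a \<noteq> 0"
    using aca \<open>a \<noteq> 0\<close> by auto
  moreover have "(c * a) * a = 0"
    using sq by (simp add: mult.assoc)
  ultimately show False
    using \<open>a \<noteq> 0\<close> by auto
qed

text \<open>
  If \<open>x y = 0\<close>, then \<open>y x\<close> has square zero, so \<open>y x = 0\<close> as well. Then both terms of
  \<open>1 = x b + c x\<close> vanish once multiplied by \<open>y\<close> on both sides, so \<open>y y = 0\<close>.
\<close>

lemma weakly_fadelian_integral:
  fixes x y :: "'a::ring_1"
  assumes wf: "weakly_fadelian TYPE('a)" and xy: "x * y = 0"
  shows "x = 0 \<or> y = 0"
proof (cases "x = 0")
  case False
  then obtain b c where one: "1 = x * b + c * x"
    by (rule weakly_fadelianE[OF wf])
  have "(y * x) * (y * x) = y * (x * y) * x"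
    by (simp only: mult.assoc)
  then have yx: "y * x = 0"
    using xy weakly_fadelian_reduced[OF wf, of "y * x"] by simp
  have "y * y = y * (x * b + c * x) * y"
    by (simp flip: one)
  also have "\<dots> = (y * x) * b * y + y * c * (x * y)"
    by (simp only: distrib_left distrib_right mult.assoc)
  also have "\<dots> = 0"
    using xy yx by simp
  finally show ?thesis
    using weakly_fadelian_reduced[OF wf, of y] by simp
qed simp

lemma right_ideal_principal: "right_ideal (range ((*) (a::'a::ring_1)))"
  unfolding right_ideal_def
proof (intro conjI ballI allI)
  show "0 \<in> range ((*) a)"
    by (rule range_eqI[of _ _ 0]) simp
  fix x assume "x \<in> range ((*) a)"
  then obtain s where x: "x = a * s" by blast
  show "- x \<in> range ((*) a)"
    by (rule range_eqI[of _ _ "- s"]) (simp add: x)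
  show "x * r \<in> range ((*) a)" for r
    by (rule range_eqI[of _ _ "s * r"]) (simp add: x mult.assoc)
  fix y assume "y \<in> range ((*) a)"
  then obtain t where "y = a * t" by blast
  then show "x + y \<in> range ((*) a)"
    by (intro range_eqI[of _ _ "s + t"]) (simp add: x distrib_left)
qed

lemma right_Ore_common_multiple:
  fixes x a :: "'a::ring_1"
  assumes "right_Ore TYPE('a)" and "x \<noteq> 0" and "a \<noteq> 0"
  obtains u v where "x * u = a * v" and "x * u \<noteq> 0"
proof -
  have nonzero: "range ((*) y) \<noteq> {0}" if "y \<noteq> 0" for y :: 'a
    using that range_eqI[of y "(*) y" 1] by auto
  have "range ((*) x) \<inter> range ((*) a) \<noteq> {0}"
    using assms(1)[unfolded right_Ore_def, rule_format,
        of "range ((*) x)" "range ((*) a)"]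
      right_ideal_principal[of x] right_ideal_principal[of a]
      nonzero[OF assms(2)] nonzero[OF assms(3)]
    by simp
  moreover have "0 \<in> range ((*) x) \<inter> range ((*) a)"
    using right_ideal_principal[of x] right_ideal_principal[of a]
    unfolding right_ideal_def by simp
  ultimately obtain w where "w \<in> range ((*) x)" "w \<in> range ((*) a)" "w \<noteq> 0"
    by blast
  then show thesis
    using that by auto
qed

theorem theorem6:
  assumes "weakly_fadelian TYPE('a::ring_1)"
    and "right_Ore TYPE('a)"
  shows "fadelian TYPE('a)"
  unfolding fadelian_def
proof (intro allI impI)
  fix x a :: 'a
  assume a: "a \<noteq> 0"
  show "\<exists>b c. x = a * b + c * a"
  proof (cases "x = 0")
    case True
    then have "x = a * 0 + 0 * a" by simp
    then show ?thesis by blast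
  next
    case False
    then obtain u v where uv: "x * u = a * v" and "x * u \<noteq> 0"
      by (rule right_Ore_common_multiple[OF assms(2) _ a])
    then have "u \<noteq> 0" by auto
    then have "u * a \<noteq> 0"
      using weakly_fadelian_integral[OF assms(1), of u a] a by auto
    then obtain b c where one: "1 = (u * a) * b + c * (u * a)"
      by (rule weakly_fadelianE[OF assms(1)])
    have "x = x * ((u * a) * b + c * (u * a))"
      by (simp flip: one)
    also have "\<dots> = (x * u) * (a * b) + (x * c * u) * a"
      by (simp only: distrib_left mult.assoc)
    also have "\<dots> = a * (v * a * b) + (x * c * u) * a"
      unfolding uv by (simp only: mult.assoc)
    finally show ?thesis by blast
  qed
qed

end
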